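(* Let $F\in\mathbf N_{-\infty}$ be nonrational with asymptotic coefficients $\{s_j\}_{j\ge0}$, let $J$ be the monic Jacobi matrix associated with $F$, let $\{\mathfrak n_j\}_{j=1}^\infty$ be the normal indices of the sequence $\mathfrak s=\{\mathfrak s_j\}_{j\ge 0}:=\{s_{j+1}\}_{j\ge 0}$, put $\mathfrak n_0=0$ and $\mathfrak k_j:=\mathfrak n_{j+1}-\mathfrak n_j$, $j\in\mathbb Z_+$. Then $J$ admits a factorization $J=LU$, where $$L=\begin{pmatrix} I_{\mathfrak k_0}&0&&\\ L_1&I_{\mathfrak k_1}&0&\\ &L_2&I_{\mathfrak k_2}&\ddots\\ &&\ddots&\ddots\end{pmatrix},\qquad U=\begin{pmatrix} U_0&D_0&&\\ 0&U_1&D_1&\\ &0&U_2&\ddots\\ &&\ddots&\ddots\end{pmatrix}$$ are block lower and block upper triangular matrices in which: $L_{j+1}$ is the $\mathfrak k_{j+1}\times\mathfrak k_j$ matrix whose upper-left entry is a number $l_{j+1}$ and whose other entries are $0$; $U_j=u_0^{(j)}$ if $\mathfrak k_j=1$ and $U_j=\begin{pmatrix}0&1\\ u_0^{(j)}&u_1^{(j)}\end{pmatrix}$ if $\mathfrak k_j=2$; and $D_j$ is the $\mathfrak k_j\times\mathfrak k_{j+1}$ matrix whose lower-left entry is $1$ and whose other entries are $0$. Moreover, this factorization is unique, and $$u_0^{(j)}=-\frac{P_{\mathfrak n_{j+1}}(0)}{P_{\mathfrak n_j}(0)},\qquad u_1^{(j)}=b_{\mathfrak n_j+1},\qquad j\in\mathbb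 Z_+$$ (the second relation for those $j$ with $\mathfrak k_j=2$, where $u_1^{(j)}$ is defined).
   Context: $\lambda\widehat\to\infty$ means that $\lambda\to\infty$ inside a sector $\varepsilon<\arg\lambda<\pi-\varepsilon$, $\varepsilon>0$. $\mathbf N$ is the class of Nevanlinna functions (analytic in $\mathbb C_+$, mapping $\mathbb C_+$ into $\mathbb C_+$). $\mathbf N_{-\infty}$ is the set of $F\in\mathbf N$ for which there are real $s_0,s_1,\dots$ with $F(\lambda)=-\frac{s_0}{\lambda}-\dots-\frac{s_{2n}}{\lambda^{2n+1}}+o(\lambda^{-2n-1})$, $\lambda\widehat\to\infty$, for every $n\in\mathbb Z_+$; equivalently $F(\lambda)=\int_{\mathbb R}\frac{d\sigma(t)}{t-\lambda}$ with a finite measure $\sigma$ on $\mathbb R$ having all moments $s_j=\int t^jd\sigma(t)$ finite. $F$ nonrational means $\operatorname{supp}\sigma$ is infinite. Let $P_j$ be the monic orthogonal polynomials of $\sigma/s_0$; they satisfy $\lambda P_j=P_{j+1}+b_jP_j+c_{j-1}P_{j-1}$, $P_{-1}=0$, $P_0=1$, $b_j\in\mathbb R$, $c_j>0$. The monic Jacobi matrix $J$ associated with $F$ is the semi-infinite tridiagonal matrix with $J_{j,j}=b_j$, $J_{j,j+1}=1$, $J_{j+1,j}=c_j$, $j\in\mathbb Z_+$. The normal indices of a real sequence $\{\mathfrak s_j\}_{j\ge0}$ are the integers $n\ge1$ with $\det(\mathfrak s_{i+k})_{i,k=0}^{n-1}\ne0$, listed increasingly as $\mathfrak n_1<\mathfrak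 n_2<\dots$. In the present situation one always has $\mathfrak k_j\in\{1,2\}$. Uniqueness is understood among factorizations of the displayed form (with the given block sizes $\mathfrak k_j$). *)

theory Defs
  imports
    "HOL-Analysis.Analysis"
    "HOL-Library.Landau_Symbols"
    "HOL-Library.Groups_Big_Fun"
    "HOL-Computational_Algebra.Polynomial"
    "Jordan_Normal_Form.Determinant"
begin

definition nevanlinna :: "(complex \<Rightarrow> complex) set" where
  "nevanlinna = {F. F holomorphic_on {z. 0 < Im z} \<and> (\<forall>z. 0 < Im z \<longrightarrow> 0 < Im (F z))}"

definition sector_infinity :: "real \<Rightarrow> complex filter" where
  "sector_infinity \<epsilon> = inf at_infinity (principal {z. \<epsilon> < Arg z \<and> Arg z < pi - \<epsilon>})"

definition has_asymptotic_coeffs :: "(complex \<Rightarrow> complex) \<Rightarrow> (nat \<Rightarrow> real) \<Rightarrow> bool" where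
  "has_asymptotic_coeffs F s \<longleftrightarrow>
     (\<forall>n. \<forall>\<epsilon>>0. (\<lambda>z. F z - (\<Sum>j\<le>2*n. - (of_real (s j) / z ^ (j + 1))))
                 \<in> o[sector_infinity \<epsilon>](\<lambda>z. 1 / z ^ (2*n + 1)))"

definition nevanlinna_minus_infinity :: "(complex \<Rightarrow> complex) set" where
  "nevanlinna_minus_infinity = {F \<in> nevanlinna. \<exists>s. has_asymptotic_coeffs F s}"

definition representing_measure :: "(complex \<Rightarrow> complex) \<Rightarrow> real measure \<Rightarrow> bool" where
  "representing_measure F \<sigma> \<longleftrightarrow>
     sets \<sigma> = sets borel \<and> finite_measure \<sigma> \<and>
     (\<forall>j. integrable \<sigma> (\<lambda>t. t ^ j)) \<and>
     (\<forall>z. 0 < Im z \<longrightarrow> F z = (\<integral>t. 1 / (of_real t - z) \<partial>\<sigma>))"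

definition measure_support :: "real measure \<Rightarrow> real set" where
  "measure_support \<sigma> = {x. \<forall>V. open V \<and> x \<in> V \<longrightarrow> 0 < emeasure \<sigma> V}"

definition monic_orthogonal_polys :: "real measure \<Rightarrow> (nat \<Rightarrow> real poly) \<Rightarrow> bool" where
  "monic_orthogonal_polys \<mu> P \<longleftrightarrow>
     (\<forall>n. degree (P n) = n \<and> lead_coeff (P n) = 1) \<and>
     (\<forall>m n. m \<noteq> n \<longrightarrow> (\<integral>t. poly (P m) t * poly (P n) t \<partial>\<mu>) = 0)"

definition jacobi_recurrence :: "(nat \<Rightarrow> real poly) \<Rightarrow> (nat \<Rightarrow> real) \<Rightarrow> (nat \<Rightarrow> real) \<Rightarrow> bool" where
  "jacobi_recurrence P b c \<longleftrightarrow>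
     (\<forall>j. c j > 0) \<and>
     (\<forall>j. [:0, 1:] * P j =
        P (j + 1) + Polynomial.smult (b j) (P j) + (if j = 0 then 0 else Polynomial.smult (c (j - 1)) (P (j - 1))))"

type_synonym inf_mat = "nat \<Rightarrow> nat \<Rightarrow> real"

definition monic_jacobi :: "(nat \<Rightarrow> real) \<Rightarrow> (nat \<Rightarrow> real) \<Rightarrow> inf_mat" where
  "monic_jacobi b c i j =
     (if j = i then b i else if j = i + 1 then 1 else if i = j + 1 then c j else 0)"

(* Sum_any adds up the nonzero terms. For block lower bidiagonal A only finitely many
   terms are nonzero, so its default value 0 for infinite supports does not occur. *)
definition inf_mat_mult :: "inf_mat \<Rightarrow> inf_mat \<Rightarrow> inf_mat" where
  "inf_mat_mult A B i j = Sum_any (\<lambda>m. A i m * B m j)"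

definition normal_index_set :: "(nat \<Rightarrow> real) \<Rightarrow> nat set" where
  "normal_index_set s = {n. 1 \<le> n \<and> Determinant.det (mat n n (\<lambda>(i, k). s (i + k))) \<noteq> 0}"

(* normal_index s j for j >= 1 is the j-th smallest normal index; this is meaningful
   for all j only if normal_index_set s is infinite. The value at 0 is the convention 0. *)
definition normal_index :: "(nat \<Rightarrow> real) \<Rightarrow> nat \<Rightarrow> nat" where
  "normal_index s j = (if j = 0 then 0 else enumerate (normal_index_set s) (j - 1))"

(* M is the infinite block matrix with blocks B p q, of size k p x k q. *)
definition has_blocks :: "(nat \<Rightarrow> nat) \<Rightarrow> (nat \<Rightarrow> nat \<Rightarrow> real mat) \<Rightarrow> inf_mat \<Rightarrow> bool" where
  "has_blocks k B M \<longleftrightarrow>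
     (\<forall>p q. \<forall>r < k p. \<forall>t < k q. M ((\<Sum>i<p. k i) + r) ((\<Sum>i<q. k i) + t) = B p q $$ (r, t))"

definition block_L :: "(nat \<Rightarrow> nat) \<Rightarrow> (nat \<Rightarrow> real) \<Rightarrow> nat \<Rightarrow> nat \<Rightarrow> real mat" where
  "block_L k l p q =
     (if p = q then 1\<^sub>m (k p)
      else if p = q + 1 then mat (k p) (k q) (\<lambda>(r, t). if r = 0 \<and> t = 0 then l p else 0)
      else 0\<^sub>m (k p) (k q))"

(* Only block sizes 1 and 2 are intended. *)
definition block_U :: "(nat \<Rightarrow> nat) \<Rightarrow> (nat \<Rightarrow> real) \<Rightarrow> (nat \<Rightarrow> real) \<Rightarrow> nat \<Rightarrow> nat \<Rightarrow> real mat" where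
  "block_U k u0 u1 p q =
     (if p = q then
        (if k p = 1 then mat_of_rows_list 1 [[u0 p]]
         else mat_of_rows_list 2 [[0, 1], [u0 p, u1 p]])
      else if q = p + 1 then
        mat (k p) (k q) (\<lambda>(r, t). if r = k p - 1 \<and> t = 0 then 1 else 0)
      else 0\<^sub>m (k p) (k q))"

definition block_LU_factorization ::
  "(nat \<Rightarrow> nat) \<Rightarrow> inf_mat \<Rightarrow> (nat \<Rightarrow> real) \<Rightarrow> (nat \<Rightarrow> real) \<Rightarrow> (nat \<Rightarrow> real)
     \<Rightarrow> inf_mat \<Rightarrow> inf_mat \<Rightarrow> bool" where
  "block_LU_factorization k J l u0 u1 L U \<longleftrightarrow>
     has_blocks k (block_L k l) L \<and> has_blocks k (block_U k u0 u1) U \<and> J = inf_mat_mult L U"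

end

theory Submission
  imports Defs
begin

text \<open>
  Everything is governed by the zeros of the sequence \<open>P n\<close> evaluated at \<open>0\<close>.

  Expanding the Cauchy kernel along the imaginary axis identifies each asymptotic coefficient
  \<open>s j\<close> with a moment of \<open>\<sigma>\<close> (lemma \<open>asymptotic_coeffs_eq_moments\<close>). The shifted Hankel matrix
  with entries \<open>s (i + k + 1)\<close> is therefore the Gram matrix of the form \<open>(p, q) \<mapsto> \<integral> t p q d\<sigma>\<close> on
  polynomials of degree below \<open>n\<close>. A kernel vector is a polynomial \<open>q\<close> for which \<open>t q\<close> is orthogonal
  to all lower degrees, hence a multiple of \<open>P n\<close>; such a \<open>q\<close> exists iff \<open>P n\<close> is divisible by the
  variable. So \<open>n\<close> is a normal index iff \<open>P n\<close> does not vanish at \<open>0\<close>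
  (lemma \<open>shifted_hankel_det_nonzero_iff\<close>).

  Since all \<open>c j\<close> are positive, the three-term recurrence forbids two consecutive zeros at \<open>0\<close>;
  this gives infinitely many normal indices with gaps \<open>1\<close> or \<open>2\<close>, a gap \<open>2\<close> occurring exactly when
  a zero is jumped over.

  Given block sizes \<open>1\<close> and \<open>2\<close>, every row of the product \<open>L U\<close> has the tridiagonal shape of a row
  of \<open>J\<close>, with superdiagonal \<open>1\<close>. Hence \<open>J = L U\<close> amounts to a few scalar equations per block
  (\<open>factor_equations\<close>). They can be solved recursively, without any choice, as long as no pivot
  vanishes, and the recurrence at \<open>0\<close> says that the negated quotients of values of the \<open>P n\<close> at
  successive normal indices are those pivots; they are nonzero because the values are. This
  yields existence, uniqueness and the formulas at once.
\<close>

section \<open>Asymptotic coefficients are moments\<close>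

lemma cauchy_kernel_expansion:
  fixes t z :: "'a::field"
  assumes "z \<noteq> 0" "t - z \<noteq> 0"
  shows "1 / (t - z) + (\<Sum>j<m. t ^ j / z ^ (j + 1)) = t ^ m / (z ^ m * (t - z))"
proof (induction m)
  case (Suc m)
  have "1 / (t - z) + (\<Sum>j<Suc m. t ^ j / z ^ (j + 1)) = t ^ m / (z ^ m * (t - z)) + t ^ m / z ^ (m + 1)"
    using Suc by (simp add: add.assoc [symmetric])
  also have "\<dots> = t ^ Suc m / (z ^ Suc m * (t - z))"
    using assms by (simp add: divide_simps) (simp add: algebra_simps)
  finally show ?case .
qed simp

text \<open>
  On the imaginary axis \<open>\<bar>t - z\<bar> \<ge> y\<close> for every real \<open>t\<close>, so the integrated remainder of the kernel
  expansion is controlled by an absolute moment. The bound has one more power of \<open>y\<close> than the last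
  term of the sum, which makes it negligible against that term.
\<close>
lemma cauchy_transform_expansion_bound:
  assumes rep: "representing_measure F \<sigma>" and y: "0 < y"
  defines "z \<equiv> of_real y * \<i>"
  shows "norm (F z + (\<Sum>j<m. of_real (\<integral>t. t ^ j \<partial>\<sigma>) / z ^ (j + 1)))
           \<le> (\<integral>t. \<bar>t\<bar> ^ m \<partial>\<sigma>) / y ^ (m + 1)"
proof -
  from rep have sets: "sets \<sigma> = sets borel" and "finite_measure \<sigma>"
    and int: "integrable \<sigma> (\<lambda>t. t ^ j)"
    and F: "0 < Im z \<Longrightarrow> F z = (\<integral>t. 1 / (of_real t - z) \<partial>\<sigma>)" for j z
    by (auto simp: representing_measure_def)
  interpret finite_measure \<sigma> by fact
  note [measurable_cong] = sets
  have [simp]: "Im z = y" "Re z = 0" "norm z = y" "z \<noteq> 0"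
    using y by (auto simp: z_def norm_mult)
  have dist: "y \<le> norm (of_real t - z)" for t :: real
    using abs_Im_le_cmod [of "of_real t - z"] y by simp
  have ne: "of_real t - z \<noteq> 0" for t :: real
    using dist [of t] y by (metis norm_zero not_less)
  have kernel: "integrable \<sigma> (\<lambda>t. 1 / (of_real t - z))"
    by (rule integrable_const_bound [where B = "1 / y"])
      (use dist y in \<open>auto simp: norm_divide intro!: divide_left_mono mult_pos_pos
          less_le_trans [OF y dist]\<close>)
  have intc: "integrable \<sigma> (\<lambda>t. of_real t ^ j / z ^ (j + 1))" for j
    using integrable_of_real [OF int [of j], where 'a = complex] by (simp del: power_Suc)
  have absint: "integrable \<sigma> (\<lambda>t. \<bar>t\<bar> ^ m)"
    using integrable_norm [OF int [of m]] by (simp add: power_abs)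
  have "F z + (\<Sum>j<m. of_real (\<integral>t. t ^ j \<partial>\<sigma>) / z ^ (j + 1))
      = (\<integral>t. 1 / (of_real t - z) \<partial>\<sigma>) + (\<Sum>j<m. \<integral>t. of_real t ^ j / z ^ (j + 1) \<partial>\<sigma>)"
    using y by (simp add: F integral_complex_of_real [symmetric])
  also have "\<dots> = (\<integral>t. 1 / (of_real t - z) + (\<Sum>j<m. of_real t ^ j / z ^ (j + 1)) \<partial>\<sigma>)"
    by (subst Bochner_Integration.integral_add)
      (use kernel intc in \<open>auto intro!: Bochner_Integration.integrable_sum simp del: power_Suc\<close>)
  also have "\<dots> = (\<integral>t. of_real t ^ m / (z ^ m * (of_real t - z)) \<partial>\<sigma>)"
    using ne by (intro Bochner_Integration.integral_cong refl cauchy_kernel_expansion) auto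
  finally have eq: "F z + (\<Sum>j<m. of_real (\<integral>t. t ^ j \<partial>\<sigma>) / z ^ (j + 1))
      = (\<integral>t. of_real t ^ m / (z ^ m * (of_real t - z)) \<partial>\<sigma>)" .
  have "norm (\<integral>t. of_real t ^ m / (z ^ m * (of_real t - z)) \<partial>\<sigma>)
      \<le> (\<integral>t. \<bar>t\<bar> ^ m / y ^ (m + 1) \<partial>\<sigma>)"
  proof (rule Bochner_Integration.integral_norm_bound_integral)
    have "integrable \<sigma> (\<lambda>t. 1 / (of_real t - z) + (\<Sum>j<m. of_real t ^ j / z ^ (j + 1)))"
      using kernel intc by (intro Bochner_Integration.integrable_add Bochner_Integration.integrable_sum)
    then show "integrable \<sigma> (\<lambda>t. of_real t ^ m / (z ^ m * (of_real t - z)))"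
      using ne by (subst (asm) cauchy_kernel_expansion) auto
    show "integrable \<sigma> (\<lambda>t. \<bar>t\<bar> ^ m / y ^ (m + 1))"
      using absint by simp
    fix t
    have "norm (of_real t ^ m / (z ^ m * (of_real t - z)) :: complex)
        = \<bar>t\<bar> ^ m / (y ^ m * norm (of_real t - z))"
      by (simp add: norm_divide norm_mult norm_power)
    also have "\<dots> \<le> \<bar>t\<bar> ^ m / (y ^ m * y)"
      using y dist [of t] by (intro divide_left_mono mult_left_mono mult_pos_pos) auto
    finally show "norm (of_real t ^ m / (z ^ m * (of_real t - z)) :: complex) \<le> \<bar>t\<bar> ^ m / y ^ (m + 1)"
      by (simp add: mult.commute)
  qed
  with eq show ?thesis by simp
qed

text \<open>
  The opening \<open>1\<close> serves as well as any number below \<open>pi / 2\<close>: one ray inside one sector suffices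
  to determine the coefficients.
\<close>
lemma filterlim_imaginary_axis_sector:
  "filterlim (\<lambda>y. of_real y * \<i>) (sector_infinity 1) at_top"
proof -
  have "filterlim (\<lambda>y::real. complex_of_real y * \<i>) at_infinity at_top"
    by (rule filterlim_norm_at_top_imp_at_infinity)
      (simp add: norm_mult filterlim_at_top_imp_at_infinity filterlim_abs_real)
  moreover have "eventually (\<lambda>y::real. complex_of_real y * \<i> \<in> {z. 1 < Arg z \<and> Arg z < pi - 1}) at_top"
    using eventually_gt_at_top [of 0] by eventually_elim (use pi_gt3 in auto)
  ultimately show ?thesis
    unfolding sector_infinity_def by (simp add: filterlim_inf filterlim_principal)
qed

lemma asymptotic_coeffs_eq_moments:
  assumes rep: "representing_measure F \<sigma>" and asy: "has_asymptotic_coeffs F s"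
  shows "s k = (\<integral>t. t ^ k \<partial>\<sigma>)"
proof (induction k rule: less_induct)
  case (less k)
  define \<mu> where "\<mu> = (\<lambda>j. \<integral>t. t ^ j \<partial>\<sigma>)"
  define d where "d j = complex_of_real (s j - \<mu> j)" for j
  define z where "z y = complex_of_real y * \<i>" for y
  define R where "R v y = z y ^ (2*k + 1) * (F (z y) + (\<Sum>j\<le>2*k. of_real (v j) / z y ^ (j + 1)))" for v y
  have z0: "z y \<noteq> 0" and nz: "norm (z y) = y" if "0 < y" for y
    using that by (auto simp: z_def norm_mult)
  have Rs: "(R s \<longlongrightarrow> 0) at_top"
  proof -
    have "(\<lambda>z. F z - (\<Sum>j\<le>2*k. - (of_real (s j) / z ^ (j + 1)))) \<in> o[sector_infinity 1](\<lambda>z. 1 / z ^ (2*k + 1))"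
      using asy by (simp add: has_asymptotic_coeffs_def del: power_Suc)
    from smalloD_tendsto [OF this] have
      "((\<lambda>w. w ^ (2*k + 1) * (F w + (\<Sum>j\<le>2*k. of_real (s j) / w ^ (j + 1)))) \<longlongrightarrow> 0) (sector_infinity 1)"
      by (simp add: sum_negf mult.commute del: power_Suc)
    from filterlim_compose [OF this filterlim_imaginary_axis_sector] show ?thesis
      unfolding R_def z_def .
  qed
  have R\<mu>: "(R \<mu> \<longlongrightarrow> 0) at_top"
  proof (rule Lim_null_comparison)
    show "((\<lambda>y. (\<integral>t. \<bar>t\<bar> ^ (2*k+1) \<partial>\<sigma>) / y) \<longlongrightarrow> 0) at_top"
      by (rule real_tendsto_divide_at_top [OF tendsto_const filterlim_ident])
    show "\<forall>\<^sub>F y in at_top. norm (R \<mu> y) \<le> (\<integral>t. \<bar>t\<bar> ^ (2*k+1) \<partial>\<sigma>) / y"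
      using eventually_gt_at_top [of "0::real"]
    proof eventually_elim
      case (elim y)
      have "norm (R \<mu> y) \<le> y ^ (2*k+1) * ((\<integral>t. \<bar>t\<bar> ^ (2*k+1) \<partial>\<sigma>) / y ^ (2*k+1+1))"
        unfolding R_def norm_mult norm_power nz [OF elim]
        using cauchy_transform_expansion_bound [OF rep elim, of "2*k+1"] elim
        by (intro mult_left_mono) (auto simp: \<mu>_def z_def lessThan_Suc_atMost simp del: power_Suc)
      also have "\<dots> = (\<integral>t. \<bar>t\<bar> ^ (2*k+1) \<partial>\<sigma>) / y"
        using elim by simp
      finally show ?case .
    qed
  qed
  \<comment> \<open>Both remainders stay small after multiplication by the power \<open>2 k + 1\<close> of \<open>z\<close>. Rescaling the
    difference by the power \<open>k + 1\<close> only isolates \<open>d k\<close>: the earlier terms vanish by induction and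
    the later ones tend to \<open>0\<close>.\<close>
  have "((\<lambda>y. z y ^ (k + 1) * (\<Sum>j\<le>2*k. d j / z y ^ (j + 1))) \<longlongrightarrow> 0) at_top"
  proof (rule Lim_null_comparison)
    show "((\<lambda>y. norm (R s y - R \<mu> y)) \<longlongrightarrow> 0) at_top"
      using tendsto_norm [OF tendsto_diff [OF Rs R\<mu>]] by simp
    show "\<forall>\<^sub>F y in at_top. norm (z y ^ (k + 1) * (\<Sum>j\<le>2*k. d j / z y ^ (j + 1))) \<le> norm (R s y - R \<mu> y)"
      using eventually_ge_at_top [of "1::real"]
    proof eventually_elim
      case (elim y)
      have "R s y - R \<mu> y = z y ^ (2*k + 1) * (\<Sum>j\<le>2*k. d j / z y ^ (j + 1))"
        by (simp add: R_def d_def diff_divide_distrib sum_subtractf right_diff_distrib [symmetric] del: power_Suc)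
      moreover have "y ^ (k + 1) \<le> y ^ (2*k + 1)"
        using elim by (intro power_increasing) auto
      ultimately show ?case
        using elim nz [of y] by (simp add: norm_mult norm_power mult_right_mono del: power_Suc)
    qed
  qed
  moreover have "((\<lambda>y. z y ^ (k + 1) * (\<Sum>j\<le>2*k. d j / z y ^ (j + 1))) \<longlongrightarrow> d k) at_top"
  proof -
    have "((\<lambda>y. z y ^ (k + 1) * (d j / z y ^ (j + 1))) \<longlongrightarrow> (if j = k then d k else 0)) at_top" for j
    proof (cases j k rule: linorder_cases)
      case less
      then have "d j = 0" using less.IH by (simp add: d_def \<mu>_def)
      with less show ?thesis by simp
    next
      case equal
      have "\<forall>\<^sub>F y in at_top. z y ^ (k + 1) * (d k / z y ^ (k + 1)) = d k"
        using eventually_gt_at_top [of "0::real"] by eventually_elim (simp add: z0)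
      with equal show ?thesis by (simp add: tendsto_eventually)
    next
      case greater
      have "filterlim z at_infinity at_top"
        using filterlim_imaginary_axis_sector unfolding sector_infinity_def filterlim_inf z_def by blast
      then have "filterlim (\<lambda>y. z y ^ (j - k)) at_infinity at_top"
        using greater by (intro Limits.filterlim_power_at_infinity) auto
      then have "((\<lambda>y. d j / z y ^ (j - k)) \<longlongrightarrow> 0) at_top"
        by (rule tendsto_divide_0 [OF tendsto_const])
      moreover have "\<forall>\<^sub>F y in at_top. d j / z y ^ (j - k) = z y ^ (k + 1) * (d j / z y ^ (j + 1))"
        using eventually_gt_at_top [of "0::real"]
      proof eventually_elim
        case (elim y)
        have "z y ^ (j + 1) = z y ^ (k + 1) * z y ^ (j - k)"
          using greater by (simp add: power_add [symmetric] del: power_Suc)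
        then show ?case using z0 [OF elim] by simp
      qed
      ultimately show ?thesis using greater by (simp add: Lim_transform_eventually)
    qed
    then have "((\<lambda>y. \<Sum>j\<le>2*k. z y ^ (k + 1) * (d j / z y ^ (j + 1))) \<longlongrightarrow> (\<Sum>j\<le>2*k. if j = k then d k else 0)) at_top"
      by (intro tendsto_sum)
    then show ?thesis by (simp add: sum_distrib_left del: power_Suc)
  qed
  ultimately have "d k = 0"
    by (intro tendsto_unique [OF trivial_limit_at_top_linorder])
  then show ?case by (simp add: d_def \<mu>_def)
qed

section \<open>Orthogonal polynomials of a functional and the shifted Hankel determinants\<close>

text \<open>
  The positive recurrence coefficients propagate positivity at \<open>1\<close> to all squared norms
  (lemma \<open>norm_P_pos\<close>). This lets the orthogonality arguments be stated for a linear functional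
  instead of a measure.
\<close>
locale orthogonal_recurrence =
  fixes E :: "real poly \<Rightarrow> real" and P :: "nat \<Rightarrow> real poly" and b c :: "nat \<Rightarrow> real"
  assumes E_add: "E (p + q) = E p + E q"
    and E_smult: "E (Polynomial.smult a p) = a * E p"
    and E_one_pos: "0 < E 1"
    and degree_P: "degree (P n) = n"
    and lead_coeff_P: "lead_coeff (P n) = 1"
    and orthogonal: "m \<noteq> n \<Longrightarrow> E (P m * P n) = 0"
    and recurrence: "jacobi_recurrence P b c"
begin

lemma E_0 [simp]: "E 0 = 0"
  using E_smult [of 0 0] by simp

lemma E_diff: "E (p - q) = E p - E q"
  using E_add [of "p - q" q] by simp

lemma E_sum: "E (\<Sum>i\<in>A. f i) = (\<Sum>i\<in>A. E (f i))"
  by (induction A rule: infinite_finite_induct) (simp_all add: E_add)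

lemma coeff_P_self: "coeff (P n) n = 1"
  using lead_coeff_P [of n] by (simp add: degree_P)

lemma coeff_P_gt: "n < i \<Longrightarrow> coeff (P n) i = 0"
  by (simp add: coeff_eq_0 degree_P)

lemma P_0: "P 0 = 1"
proof -
  obtain a where "P 0 = [:a:]"
    using degree_P [of 0] degree_eq_zeroE by blast
  then show ?thesis using coeff_P_self [of 0] by (simp add: one_pCons)
qed

text \<open>
  Degree bounds are written as vanishing coefficients so that the zero polynomial and the bound
  \<open>d = 0\<close> need no separate treatment: subtracting a multiple of \<open>P d\<close> removes the top coefficient.
\<close>
lemma orthogonal_lower:
  assumes "d \<le> n" "\<And>i. d \<le> i \<Longrightarrow> coeff q i = 0"
  shows "E (P n * q) = 0"
  using assms
proof (induction d arbitrary: q)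
  case 0
  then have "q = 0" by (auto intro: poly_eqI)
  then show ?case by simp
next
  case (Suc d)
  let ?r = "q - Polynomial.smult (coeff q d) (P d)"
  have "E (P n * ?r) = 0"
  proof (rule Suc.IH)
    fix i assume "d \<le> i"
    then show "coeff ?r i = 0"
      using Suc.prems(2) [of i] by (cases "i = d") (simp_all add: coeff_P_self coeff_P_gt)
  qed (use Suc.prems in simp)
  moreover have "E (P n * ?r) = E (P n * q) - coeff q d * E (P n * P d)"
    by (simp add: right_diff_distrib E_diff E_smult)
  ultimately show ?case
    using orthogonal [of n d] Suc.prems(1) by simp
qed

lemma E_P_mult_same_degree:
  assumes "\<And>i. n < i \<Longrightarrow> coeff q i = 0"
  shows "E (P n * q) = coeff q n * E (P n * P n)"
proof -
  let ?r = "q - Polynomial.smult (coeff q n) (P n)"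
  have "E (P n * ?r) = 0"
  proof (rule orthogonal_lower [OF order_refl])
    fix i assume "n \<le> i"
    then show "coeff ?r i = 0"
      using assms [of i] by (cases "i = n") (simp_all add: coeff_P_self coeff_P_gt)
  qed
  then show ?thesis by (simp add: right_diff_distrib E_diff E_smult)
qed

lemma c_pos: "0 < c n"
  using recurrence by (simp add: jacobi_recurrence_def)

lemma X_mult_P:
  "[:0, 1:] * P n = P (Suc n) + Polynomial.smult (b n) (P n)
     + (if n = 0 then 0 else Polynomial.smult (c (n - 1)) (P (n - 1)))"
  using recurrence by (simp add: jacobi_recurrence_def)

lemma norm_P_pos: "0 < E (P n * P n)"
proof (induction n)
  case 0
  then show ?case by (simp add: P_0 E_one_pos)
next
  case (Suc n)
  \<comment> \<open>Evaluate \<open>E (x * P n * P (Suc n))\<close> in two ways, attaching \<open>x\<close> to either factor.\<close>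
  have "E (P (Suc n) * ([:0, 1:] * P n)) = coeff ([:0, 1:] * P n) (Suc n) * E (P (Suc n) * P (Suc n))"
    by (rule E_P_mult_same_degree) (auto simp: coeff_pCons coeff_P_gt split: nat.splits)
  then have "E (P (Suc n) * ([:0, 1:] * P n)) = E (P (Suc n) * P (Suc n))"
    by (simp add: coeff_P_self)
  moreover have "P (Suc n) * ([:0, 1:] * P n) = P n * ([:0, 1:] * P (Suc n))"
    by (simp only: mult.left_commute mult.commute)
  moreover have "E (P n * ([:0, 1:] * P (Suc n))) = c n * E (P n * P n)"
    unfolding X_mult_P [of "Suc n"]
    by (simp add: distrib_left E_add E_smult orthogonal)
  ultimately have "E (P (Suc n) * P (Suc n)) = c n * E (P n * P n)"
    by metis
  then show ?case using Suc c_pos [of n] by simp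
qed

text \<open>
  Uniqueness of the orthogonal polynomial: after subtracting the multiple of \<open>P n\<close>, a nonzero
  remainder of degree \<open>d < n\<close> would be orthogonal to \<open>P d\<close>, although its product with \<open>P d\<close> has
  the value (leading coefficient) times (positive squared norm).
\<close>
lemma orthogonal_monom_imp_multiple_P:
  assumes deg: "\<And>i. n < i \<Longrightarrow> coeff q i = 0"
    and orth: "\<And>i. i < n \<Longrightarrow> E (q * monom 1 i) = 0"
  shows "q = Polynomial.smult (coeff q n) (P n)"
proof (rule ccontr)
  let ?r = "q - Polynomial.smult (coeff q n) (P n)"
  assume "\<not> ?thesis"
  then have nz: "?r \<noteq> 0" by simp
  define d where "d = degree ?r"
  have "coeff ?r i = 0" if "n \<le> i" for i
    using that deg [of i] by (cases "i = n") (simp_all add: coeff_P_self coeff_P_gt)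
  with nz have d: "d < n"
    unfolding d_def by (meson leading_coeff_0_iff not_le)
  have "E (?r * monom 1 i) = 0" if "i < n" for i
    using orth [OF that] orthogonal_lower [of "Suc i" n "monom 1 i"] that
    by (simp add: left_diff_distrib E_diff E_smult coeff_monom)
  note mono1 = this
  have mono: "E (?r * monom a i) = 0" if "i < n" for a i
  proof -
    have "?r * monom a i = Polynomial.smult a (?r * monom 1 i)"
      by (metis mult.right_neutral mult_smult_right smult_monom)
    with mono1 [OF that] show ?thesis by (simp only: E_smult mult_zero_right)
  qed
  have "P d = (\<Sum>i\<le>d. monom (coeff (P d) i) i)"
    using poly_as_sum_of_monoms [of "P d"] by (simp add: degree_P)
  then have "E (?r * P d) = E (?r * (\<Sum>i\<le>d. monom (coeff (P d) i) i))"
    by (rule arg_cong)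
  also have "\<dots> = (\<Sum>i\<le>d. E (?r * monom (coeff (P d) i) i))"
    by (simp only: sum_distrib_left E_sum)
  also have "\<dots> = 0"
    using d mono by (intro sum.neutral) auto
  finally have "E (?r * P d) = 0" .
  moreover have "E (P d * ?r) = coeff ?r d * E (P d * P d)"
    by (rule E_P_mult_same_degree) (simp only: d_def coeff_eq_0)
  ultimately have "coeff ?r d = 0"
    using norm_P_pos [of d] by (simp add: mult.commute)
  with nz show False by (metis d_def leading_coeff_0_iff)
qed

text \<open>
  A vector \<open>v\<close> stands for the polynomial \<open>Q v\<close> with these coefficients; applying the matrix to \<open>v\<close>
  tests \<open>x * Q v\<close> against the monomials of degree below \<open>n\<close>. Kernel vectors thus correspond to the
  factorizations of multiples of \<open>P n\<close> as \<open>x * q\<close>.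
\<close>
lemma shifted_hankel_det_nonzero_iff:
  "Determinant.det (mat n n (\<lambda>(i, k). E (monom 1 (i + k + 1)))) \<noteq> 0 \<longleftrightarrow> poly (P n) 0 \<noteq> 0"
proof -
  let ?A = "mat n n (\<lambda>(i, k). E (monom 1 (i + k + 1)))"
  define Q where "Q v = (\<Sum>k<n. monom (v $ k) k)" for v :: "real vec"
  have coeff_Q: "coeff (Q v) i = (if i < n then v $ i else 0)" for v i
    by (simp add: Q_def coeff_sum coeff_monom sum.delta)
  have mult: "(?A *\<^sub>v v) $ i = E ([:0, 1:] * Q v * monom 1 i)"
    if "v \<in> carrier_vec n" "i < n" for v i
  proof -
    have "[:0, 1:] * Q v * monom 1 i = (\<Sum>k<n. Polynomial.smult (v $ k) (monom 1 (i + k + 1)))"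
    proof -
      have "[:0, 1:] * monom (v $ k) k * monom 1 i = Polynomial.smult (v $ k) (monom 1 (i + k + 1))" for k
      proof -
        have "[:0, 1:] = monom (1::real) 1" by (simp add: monom_altdef)
        then show ?thesis by (simp add: mult_monom smult_monom add.commute)
      qed
      then show ?thesis by (simp only: Q_def sum_distrib_left sum_distrib_right)
    qed
    then have "E ([:0, 1:] * Q v * monom 1 i) = (\<Sum>k<n. v $ k * E (monom 1 (i + k + 1)))"
      by (simp add: E_sum E_smult)
    also have "\<dots> = (?A *\<^sub>v v) $ i"
      using that by (simp add: scalar_prod_def atLeast0LessThan mult.commute)
    finally show ?thesis by simp
  qed
  have "Determinant.det ?A = 0 \<longleftrightarrow> (\<exists>v. v \<in> carrier_vec n \<and> v \<noteq> 0\<^sub>v n \<and> ?A *\<^sub>v v = 0\<^sub>v n)"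
    by (rule det_0_iff_vec_prod_zero_field) simp
  also have "\<dots> \<longleftrightarrow> poly (P n) 0 = 0"
  proof (intro iffI; (elim exE conjE)?)
    fix v assume v: "v \<in> carrier_vec n" "v \<noteq> 0\<^sub>v n" "?A *\<^sub>v v = 0\<^sub>v n"
    let ?q = "[:0, 1:] * Q v"
    have "?q = Polynomial.smult (coeff ?q n) (P n)"
    proof (rule orthogonal_monom_imp_multiple_P)
      show "coeff ?q i = 0" if "n < i" for i
        using that by (cases i) (simp_all add: coeff_Q)
      show "E (?q * monom 1 i) = 0" if "i < n" for i
        using mult [OF v(1) that] that by (simp only: v(3) index_zero_vec)
    qed
    moreover have "Q v \<noteq> 0"
    proof
      assume "Q v = 0"
      then have "v $ i = 0" if "i < n" for i
        using coeff_Q [of v i] that by simp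
      then have "v = 0\<^sub>v n" using v(1) by (intro eq_vecI) auto
      with v(2) show False by simp
    qed
    ultimately have "poly ?q 0 = coeff ?q n * poly (P n) 0" "coeff ?q n \<noteq> 0"
      by (metis poly_smult, metis mult_eq_0_iff pCons_eq_0_iff smult_0_left zero_neq_one)
    then show "poly (P n) 0 = 0" by simp
  next
    assume root: "poly (P n) 0 = 0"
    then obtain q where q: "P n = [:0, 1:] * q"
      by (metis dvd_def minus_zero poly_eq_0_iff_dvd)
    from root have "n \<noteq> 0" by (metis P_0 poly_1 zero_neq_one)
    have cq: "coeff q i = coeff (P n) (Suc i)" for i by (simp add: q)
    define v where "v = vec n (coeff q)"
    have v: "v \<in> carrier_vec n" by (simp add: v_def)
    have Qv: "Q v = q"
      by (rule poly_eqI) (auto simp: coeff_Q v_def cq coeff_P_gt)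
    have "v $ (n - 1) = 1"
      using \<open>n \<noteq> 0\<close> by (simp add: v_def cq coeff_P_self)
    then have "v \<noteq> 0\<^sub>v n" using \<open>n \<noteq> 0\<close> by auto
    moreover have "?A *\<^sub>v v = 0\<^sub>v n"
    proof (rule eq_vecI)
      fix i assume "i < dim_vec (0\<^sub>v n :: real vec)"
      then have i: "i < n" by simp
      have "(?A *\<^sub>v v) $ i = E (P n * monom 1 i)"
        using mult [OF v i] by (simp only: Qv q)
      also have "\<dots> = 0"
        using i by (intro orthogonal_lower [of "Suc i"]) (auto simp: coeff_monom)
      finally show "(?A *\<^sub>v v) $ i = 0\<^sub>v n $ i" using i by simp
    qed simp
    ultimately show "\<exists>v. v \<in> carrier_vec n \<and> v \<noteq> 0\<^sub>v n \<and> ?A *\<^sub>v v = 0\<^sub>v n"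
      using v by blast
  qed
  finally show ?thesis by blast
qed

end

text \<open>
  Orthogonality is assumed for the normalized measure. Multiplication by the total mass \<open>s 0\<close>, which
  is positive once the support is nonempty, transfers it to \<open>\<sigma>\<close> itself; working with \<open>\<sigma>\<close> has the
  advantage that its moments are the \<open>s j\<close> without a factor.
\<close>
lemma orthogonal_recurrence_of_measure:
  assumes rep: "representing_measure F \<sigma>" and asy: "has_asymptotic_coeffs F s"
    and supp: "measure_support \<sigma> \<noteq> {}"
    and orth: "monic_orthogonal_polys (scale_measure (ennreal (1 / s 0)) \<sigma>) P"
    and rec: "jacobi_recurrence P b c"
  shows "orthogonal_recurrence (\<lambda>p. \<integral>t. poly p t \<partial>\<sigma>) P b c"
proof -
  from rep have sets: "sets \<sigma> = sets borel" and "finite_measure \<sigma>"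
    and int: "integrable \<sigma> (\<lambda>t. t ^ j)" for j
    by (auto simp: representing_measure_def)
  interpret finite_measure \<sigma> by fact
  note [measurable_cong] = sets
  have pint: "integrable \<sigma> (poly p)" for p
    unfolding poly_altdef [abs_def] using int by (intro Bochner_Integration.integrable_sum) auto
  have sp: "space \<sigma> = UNIV"
    using sets_eq_imp_space_eq [OF sets] by simp
  have pos: "0 < measure \<sigma> UNIV"
    using supp by (auto simp: measure_support_def emeasure_eq_measure)
  have s0: "s 0 = measure \<sigma> UNIV"
    using asymptotic_coeffs_eq_moments [OF rep asy, of 0] by (simp add: sp)
  have scale: "(\<integral>t. f t \<partial>scale_measure (ennreal (1 / s 0)) \<sigma>) = 1 / s 0 * (\<integral>t. f t \<partial>\<sigma>)"
    if [measurable]: "f \<in> borel_measurable borel" for f :: "real \<Rightarrow> real"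
  proof -
    have "scale_measure (ennreal (1 / s 0)) \<sigma> = density \<sigma> (\<lambda>_. ennreal (1 / s 0))"
      by (rule measure_eqI) (simp_all add: emeasure_density_const)
    then show ?thesis
      using pos by (simp add: integral_density s0)
  qed
  show ?thesis
  proof
    show "(\<integral>t. poly (p + q) t \<partial>\<sigma>) = (\<integral>t. poly p t \<partial>\<sigma>) + (\<integral>t. poly q t \<partial>\<sigma>)" for p q
      using pint by simp
    show "(\<integral>t. poly (P m * P n) t \<partial>\<sigma>) = 0" if "m \<noteq> n" for m n
    proof -
      have [measurable]: "poly p \<in> borel_measurable borel" for p :: "real poly"
        by (intro borel_measurable_continuous_onI continuous_intros)
      have "(\<integral>t. poly (P m) t * poly (P n) t \<partial>scale_measure (ennreal (1 / s 0)) \<sigma>) = 0"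
        using orth that by (simp add: monic_orthogonal_polys_def)
      then show ?thesis
        using pos by (subst (asm) scale) (simp_all add: s0)
    qed
    show "lead_coeff (P n) = 1" for n
      using orth unfolding monic_orthogonal_polys_def by blast
  qed (use orth rec pos sp in \<open>auto simp: monic_orthogonal_polys_def\<close>)
qed

section \<open>Gaps between normal indices\<close>

lemma (in orthogonal_recurrence) P_Suc_at_0:
  "poly (P (Suc n)) 0 = - b n * poly (P n) 0 - (if n = 0 then 0 else c (n - 1) * poly (P (n - 1)) 0)"
  using arg_cong [OF X_mult_P [of n], of "\<lambda>p. poly p 0"] by (simp split: if_splits)

text \<open>
  Two consecutive zeros would propagate down the recurrence, as \<open>c n \<noteq> 0\<close>, and reach \<open>P 0 = 1\<close>.
\<close>
lemma (in orthogonal_recurrence) no_consecutive_zeros: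
  "poly (P n) 0 \<noteq> 0 \<or> poly (P (Suc n)) 0 \<noteq> 0"
proof (induction n)
  case (Suc n)
  then show ?case using P_Suc_at_0 [of "Suc n"] c_pos [of n] by auto
qed (simp add: P_0)

text \<open>
  Normal indices are at least \<open>1\<close>, so the convention \<open>normal_index s 0 = 0\<close> lets the first index
  obey the same successor rule as all others.
\<close>
lemma normal_index_Suc:
  assumes "infinite (normal_index_set s)"
  shows "normal_index s (Suc j) = (LEAST n. n \<in> normal_index_set s \<and> normal_index s j < n)"
proof (cases j)
  case 0
  have "(\<lambda>n. n \<in> normal_index_set s \<and> 0 < n) = (\<lambda>n. n \<in> normal_index_set s)"
    by (auto simp: normal_index_set_def fun_eq_iff)
  with 0 show ?thesis by (simp add: normal_index_def enumerate_0)
qed (simp add: normal_index_def enumerate_Suc'' [OF assms])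

lemma normal_indices_of_isolated_zeros:
  assumes normal: "\<And>n. 1 \<le> n \<Longrightarrow> n \<in> normal_index_set s \<longleftrightarrow> a n \<noteq> 0"
    and isolated: "\<And>n. a n \<noteq> 0 \<or> a (Suc n) \<noteq> 0"
    and a0: "a 0 \<noteq> 0"
  shows "infinite (normal_index_set s)"
    and "a (normal_index s j) \<noteq> 0"
    and "normal_index s (Suc j) = normal_index s j + (if a (Suc (normal_index s j)) = 0 then 2 else 1)"
proof -
  have "\<exists>n>m. n \<in> normal_index_set s" for m
    using isolated [of "Suc m"] normal [of "Suc m"] normal [of "Suc (Suc m)"]
    by (metis le_add1 lessI less_SucI plus_1_eq_Suc)
  then show inf: "infinite (normal_index_set s)"
    by (auto simp: infinite_nat_iff_unbounded)
  show "a (normal_index s j) \<noteq> 0"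
  proof (cases j)
    case (Suc i)
    have "normal_index s j \<in> normal_index_set s"
      using enumerate_in_set [OF inf] by (simp add: normal_index_def Suc)
    then show ?thesis using normal by (auto simp: normal_index_set_def)
  qed (simp add: normal_index_def a0)
  let ?n = "normal_index s j"
  show "normal_index s (Suc j) = ?n + (if a (Suc ?n) = 0 then 2 else 1)"
    unfolding normal_index_Suc [OF inf]
  proof (rule Least_equality)
    show "?n + (if a (Suc ?n) = 0 then 2 else 1) \<in> normal_index_set s \<and>
      ?n < ?n + (if a (Suc ?n) = 0 then 2 else 1)"
      using isolated [of "Suc ?n"] by (simp add: normal)
    show "?n + (if a (Suc ?n) = 0 then 2 else 1) \<le> m"
      if "m \<in> normal_index_set s \<and> ?n < m" for m
      using that normal [of m] by (cases "m = Suc ?n") auto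
  qed
qed

section \<open>Block bidiagonal factors with blocks of size one and two\<close>

locale block_sizes =
  fixes k :: "nat \<Rightarrow> nat"
  assumes size: "k p = 1 \<or> k p = 2"
begin

definition start :: "nat \<Rightarrow> nat" where
  "start p = (\<Sum>i<p. k i)"

lemma start_0 [simp]: "start 0 = 0"
  and start_Suc: "start (Suc p) = start p + k p"
  by (simp_all add: start_def)

lemma start_less_mono: "p < q \<Longrightarrow> start p + k p \<le> start q"
  by (induction q) (auto simp: start_Suc less_Suc_eq)

lemma block_position_exists: "\<exists>p r. r < k p \<and> i = start p + r"
proof (induction i)
  case 0
  show ?case using size [of 0] by (intro exI [of _ 0]) auto
next
  case (Suc i)
  then obtain p r where pr: "r < k p" "i = start p + r" by blast
  show ?case
  proof (cases "Suc r < k p")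
    case True
    with pr show ?thesis by (intro exI [of _ p] exI [of _ "Suc r"]) simp
  next
    case False
    with pr have "Suc i = start (Suc p) + 0" by (simp add: start_Suc)
    then show ?thesis using size [of "Suc p"] by (intro exI [of _ "Suc p"] exI [of _ 0]) auto
  qed
qed

lemma block_position_unique:
  assumes "start p + r = start q + t" "r < k p" "t < k q"
  shows "p = q \<and> r = t"
  using assms start_less_mono [of p q] start_less_mono [of q p]
  by (cases p q rule: linorder_cases) auto

lemma has_blocks_entry:
  "has_blocks k B M \<Longrightarrow> r < k p \<Longrightarrow> t < k q \<Longrightarrow> M (start p + r) (start q + t) = B p q $$ (r, t)"
  by (simp add: has_blocks_def start_def)

lemma has_blocks_unique:
  assumes "has_blocks k B M" "has_blocks k B M'"
  shows "M = M'"
proof (intro ext)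
  fix i j
  obtain p r q t where "r < k p" "i = start p + r" "t < k q" "j = start q + t"
    using block_position_exists by metis
  with assms show "M i j = M' i j" by (simp add: has_blocks_entry)
qed

lemma has_blocks_exists: "\<exists>M. has_blocks k B M"
proof -
  obtain blk off where pos: "\<And>i. off i < k (blk i)" "\<And>i. i = start (blk i) + off i"
    using block_position_exists by metis
  have at: "blk (start p + r) = p \<and> off (start p + r) = r" if "r < k p" for p r
    using block_position_unique pos that by metis
  have "has_blocks k B (\<lambda>i j. B (blk i) (blk j) $$ (off i, off j))"
    using at by (simp add: has_blocks_def start_def)
  then show ?thesis by blast
qed

text \<open>
  A block of size two has \<open>0\<close> in its upper-left corner, and its entry \<open>1\<close> lies on the superdiagonal
  of the whole matrix, as do the entries \<open>1\<close> of the \<open>D\<close> blocks. So the superdiagonal of \<open>U\<close> is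
  constantly \<open>1\<close>, and in the first row of a block only the diagonal entry depends on the size.
\<close>
lemma U_row_first:
  assumes "has_blocks k (block_U k u0 u1) U"
  shows "U (start p) j =
    (if j = start p then (if k p = 1 then u0 p else 0) else if j = start p + 1 then 1 else 0)"
proof -
  obtain q t where t: "t < k q" "j = start q + t" using block_position_exists by blast
  have "U (start p + 0) (start q + t) = block_U k u0 u1 p q $$ (0, t)"
    using size [of p] by (intro has_blocks_entry [OF assms _ t(1)]) auto
  then have entry: "U (start p) j = block_U k u0 u1 p q $$ (0, t)" by (simp add: t)
  consider "q < p" | "q = p" | "q = Suc p" | "Suc p < q" by linarith
  then show ?thesis
  proof cases
    case 1
    then show ?thesis
      using entry t start_less_mono [of q p] size [of p] by (auto simp: block_U_def)
  next
    case 2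
    with t size [of p] consider "k p = 1" "t = 0" | "k p = 2" "t = 0" | "k p = 2" "t = 1"
      by (auto simp: less_2_cases_iff)
    then show ?thesis
      using 2 entry t by cases (simp_all add: block_U_def mat_of_rows_list_def)
  next
    case 3
    with t have "j = start p + k p + t" by (simp add: start_Suc)
    with 3 t(1) show ?thesis
      unfolding entry by (cases "k p = 1") (use size [of p] in \<open>simp_all add: block_U_def\<close>)
  next
    case 4
    have "0 < k p" "0 < k (Suc p)"
      using size [of p] size [of "Suc p"] by auto
    then have "start p + 1 < j"
      using start_less_mono [OF 4] start_Suc [of p] t by linarith
    with 4 t(1) \<open>0 < k p\<close> show ?thesis
      unfolding entry by (simp add: block_U_def)
  qed
qed

lemma U_row_second:
  assumes "has_blocks k (block_U k u0 u1) U" "k p = 2"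
  shows "U (Suc (start p)) j =
    (if j = start p then u0 p else if j = start p + 1 then u1 p else if j = start p + 2 then 1 else 0)"
proof -
  obtain q t where t: "t < k q" "j = start q + t" using block_position_exists by blast
  have "U (start p + 1) (start q + t) = block_U k u0 u1 p q $$ (1, t)"
    using \<open>k p = 2\<close> by (intro has_blocks_entry [OF assms(1) _ t(1)]) simp
  then have entry: "U (Suc (start p)) j = block_U k u0 u1 p q $$ (1, t)" by (simp add: t)
  consider "q < p" | "q = p" | "q = Suc p" | "Suc p < q" by linarith
  then show ?thesis
  proof cases
    case 1
    then show ?thesis
      using entry t start_less_mono [of q p] \<open>k p = 2\<close> by (auto simp: block_U_def)
  next
    case 2
    then show ?thesis
      using entry t \<open>k p = 2\<close> by (auto simp: block_U_def mat_of_rows_list_def less_2_cases_iff)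
  next
    case 3
    then show ?thesis
      using entry t \<open>k p = 2\<close> by (auto simp: block_U_def start_Suc)
  next
    case 4
    then show ?thesis
      using entry t start_less_mono [of "Suc p" q] start_Suc [of p] \<open>k p = 2\<close> size [of "Suc p"]
      by (auto simp: block_U_def)
  qed
qed

lemma L_row_first:
  assumes "has_blocks k (block_L k l) L"
  shows "L (start p) j =
    (if j = start p then 1 else if 0 < p \<and> j = start (p - 1) then l p else 0)"
proof -
  obtain q t where t: "t < k q" "j = start q + t" using block_position_exists by blast
  have "L (start p + 0) (start q + t) = block_L k l p q $$ (0, t)"
    using size [of p] by (intro has_blocks_entry [OF assms _ t(1)]) auto
  then have entry: "L (start p) j = block_L k l p q $$ (0, t)" by (simp add: t)
  have "0 < k r" for r
    using size [of r] by auto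
  then have position: "j = start r \<longleftrightarrow> q = r \<and> t = 0" for r
    using block_position_unique [of q t r 0] t by auto
  show ?thesis
    unfolding entry position using t(1) size [of p] by (auto simp: block_L_def)
qed

lemma L_row_second:
  assumes "has_blocks k (block_L k l) L" "k p = 2"
  shows "L (Suc (start p)) j = (if j = Suc (start p) then 1 else 0)"
proof -
  obtain q t where t: "t < k q" "j = start q + t" using block_position_exists by blast
  have "L (start p + 1) (start q + t) = block_L k l p q $$ (1, t)"
    using \<open>k p = 2\<close> by (intro has_blocks_entry [OF assms(1) _ t(1)]) simp
  then have entry: "L (Suc (start p)) j = block_L k l p q $$ (1, t)" by (simp add: t)
  have position: "j = Suc (start p) \<longleftrightarrow> q = p \<and> t = 1"
    using block_position_unique [of q t p 1] t \<open>k p = 2\<close> by auto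
  show ?thesis
    unfolding entry position using t(1) \<open>k p = 2\<close> by (auto simp: block_L_def)
qed

text \<open>
  Row \<open>start p\<close> of \<open>L\<close> has at most two nonzero entries, so the infinite sum in the product is a
  sum over two indices.
\<close>
lemma LU_row_first:
  assumes "has_blocks k (block_L k l) L"
  shows "inf_mat_mult L U (start p) j =
    U (start p) j + (if 0 < p then l p * U (start (p - 1)) j else 0)"
proof -
  have ne: "start p \<noteq> start (p - 1)" if "0 < p"
    using start_less_mono [of "p - 1" p] size [of "p - 1"] that by auto
  have "inf_mat_mult L U (start p) j = (\<Sum>m\<in>{start p, start (p - 1)}. L (start p) m * U m j)"
    unfolding inf_mat_mult_def
    by (rule Sum_any.expand_superset) (auto simp: L_row_first [OF assms])
  also have "\<dots> = U (start p) j + (if 0 < p then l p * U (start (p - 1)) j else 0)"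
    using ne L_row_first [OF assms, of 0 0] by (cases "p = 0") (auto simp: L_row_first [OF assms])
  finally show ?thesis .
qed

lemma LU_row_second:
  assumes "has_blocks k (block_L k l) L" "k p = 2"
  shows "inf_mat_mult L U (Suc (start p)) j = U (Suc (start p)) j"
proof -
  have "inf_mat_mult L U (Suc (start p)) j = (\<Sum>m\<in>{Suc (start p)}. L (Suc (start p)) m * U m j)"
    unfolding inf_mat_mult_def
    by (rule Sum_any.expand_superset) (auto simp: L_row_second [OF assms])
  then show ?thesis by (simp add: L_row_second [OF assms])
qed

text \<open>
  The first two equations compare the diagonal and subdiagonal entries in the first row of block
  \<open>p\<close>. Into that row \<open>l p\<close> carries the first row of the previous block, whose final entry \<open>1\<close> sits
  in column \<open>start p\<close> if that block has size one, but in column \<open>start p - 1\<close> if it has size two;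
  this is the reason for the case distinctions. The third equation is the second row of a block of
  size two, which \<open>L\<close> leaves unchanged.
\<close>
definition factor_equations ::
  "(nat \<Rightarrow> real) \<Rightarrow> (nat \<Rightarrow> real) \<Rightarrow> (nat \<Rightarrow> real) \<Rightarrow> (nat \<Rightarrow> real) \<Rightarrow> (nat \<Rightarrow> real) \<Rightarrow> nat \<Rightarrow> bool" where
  "factor_equations b c l u0 u1 p \<longleftrightarrow>
     (if k p = 1 then u0 p else 0) + (if 0 < p \<and> k (p - 1) = 1 then l p else 0) = b (start p) \<and>
     (0 < p \<longrightarrow> l p * (if k (p - 1) = 1 then u0 (p - 1) else 1) = c (start p - 1)) \<and>
     (k p = 2 \<longrightarrow> u0 p = c (start p) \<and> u1 p = b (Suc (start p)))"

lemma jacobi_rows_iff_factor_equations: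
  assumes L: "has_blocks k (block_L k l) L" and U: "has_blocks k (block_U k u0 u1) U"
  shows "(\<forall>r<k p. \<forall>j. monic_jacobi b c (start p + r) j = inf_mat_mult L U (start p + r) j)
           \<longleftrightarrow> factor_equations b c l u0 u1 p"
proof -
  have first: "(\<forall>j. monic_jacobi b c (start p) j = inf_mat_mult L U (start p) j) \<longleftrightarrow>
     (if k p = 1 then u0 p else 0) + (if 0 < p \<and> k (p - 1) = 1 then l p else 0) = b (start p) \<and>
     (0 < p \<longrightarrow> l p * (if k (p - 1) = 1 then u0 (p - 1) else 1) = c (start p - 1))"
    (is "(\<forall>j. ?e j) \<longleftrightarrow> ?rhs")
  proof -
    have row: "inf_mat_mult L U (start p) j =
      (if j = start p then (if k p = 1 then u0 p else 0) + (if 0 < p \<and> k (p - 1) = 1 then l p else 0)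
       else if j = start p + 1 then 1
       else if start p = j + 1 then l p * (if k (p - 1) = 1 then u0 (p - 1) else 1) else 0)" for j
    proof (cases p)
      case 0
      then show ?thesis
        using LU_row_first [OF L, of U 0 j] U_row_first [OF U, of 0 j] by simp
    next
      case (Suc q)
      then have "inf_mat_mult L U (start p) j = U (start p) j + l p * U (start q) j"
        using LU_row_first [OF L, of U p j] by simp
      then show ?thesis
        unfolding U_row_first [OF U] by (cases "k q = 1") (use size [of q] in \<open>simp_all add: Suc start_Suc\<close>)
    qed
    have pred: "start p = Suc (start p - 1)" if "0 < p"
      using start_less_mono [of "p - 1" p] size [of "p - 1"] that by auto
    show ?thesis
    proof (intro iffI allI)
      assume "\<forall>j. ?e j"
      then have "?e (start p)" "?e (start p - 1)" by blast+
      moreover have "start p - 1 \<noteq> start p \<and> start p = start p - 1 + 1" if "0 < p"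
        using pred [OF that] by linarith
      ultimately show ?rhs
        unfolding row monic_jacobi_def by (cases "0 < p") (simp_all split: if_splits)
    next
      fix j
      assume rhs: ?rhs
      have "0 < p \<and> j = start p - 1" if "start p = j + 1"
        using that by (cases p) auto
      with rhs show "?e j"
        unfolding row monic_jacobi_def by auto
    qed
  qed
  have second: "(\<forall>j. monic_jacobi b c (Suc (start p)) j = inf_mat_mult L U (Suc (start p)) j) \<longleftrightarrow>
      u0 p = c (start p) \<and> u1 p = b (Suc (start p))" (is "(\<forall>j. ?e j) \<longleftrightarrow> ?rhs") if "k p = 2"
  proof (intro iffI allI)
    assume "\<forall>j. ?e j"
    then have "?e (start p)" "?e (Suc (start p))" by blast+
    then show ?rhs
      unfolding LU_row_second [OF L that] U_row_second [OF U that] monic_jacobi_def by simp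
  next
    fix j
    assume ?rhs
    then show "?e j"
      unfolding LU_row_second [OF L that] U_row_second [OF U that] monic_jacobi_def by simp
  qed
  have rows: "(\<forall>r<k p. Q r) \<longleftrightarrow> Q 0 \<and> (k p = 2 \<longrightarrow> Q 1)" for Q
    using size [of p] by (auto simp: less_2_cases_iff)
  show ?thesis
    unfolding rows factor_equations_def add_0_right first
    using second by auto
qed

lemma block_LU_factorization_iff:
  "block_LU_factorization k (monic_jacobi b c) l u0 u1 L U \<longleftrightarrow>
     has_blocks k (block_L k l) L \<and> has_blocks k (block_U k u0 u1) U \<and>
     (\<forall>p. factor_equations b c l u0 u1 p)"
proof -
  have "monic_jacobi b c = M \<longleftrightarrow>
      (\<forall>p. \<forall>r<k p. \<forall>j. monic_jacobi b c (start p + r) j = M (start p + r) j)" for M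
    using block_position_exists by (metis ext)
  then show ?thesis
    unfolding block_LU_factorization_def
    using jacobi_rows_iff_factor_equations [of l L u0 u1 U _ b c] by blast
qed

end

section \<open>Solving the factor equations\<close>

text \<open>
  With this choice of sizes the blocks start exactly at the indices with nonvanishing value at \<open>0\<close>,
  and a zero is absorbed as the second index of a block of size two.
\<close>
locale jacobi_blocks = orthogonal_recurrence E P b c + block_sizes k
  for E P b c k +
  assumes size_zero: "k p = (if poly (P (Suc (start p))) 0 = 0 then 2 else 1)"
begin

definition pivot :: "nat \<Rightarrow> real" where
  "pivot p = - (poly (P (start (Suc p))) 0 / poly (P (start p)) 0)"

definition multiplier :: "nat \<Rightarrow> real" where
  "multiplier p = c (start p - 1) / (if k (p - 1) = 1 then pivot (p - 1) else 1)"

lemma P_start_nonzero: "poly (P (start p)) 0 \<noteq> 0"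
proof (cases p)
  case (Suc q)
  then show ?thesis
    using size_zero [of q] no_consecutive_zeros [of "Suc (start q)"]
    by (auto simp: start_Suc split: if_splits)
qed (simp add: P_0)

lemma pivot_nonzero: "pivot p \<noteq> 0"
  using P_start_nonzero by (simp add: pivot_def)

lemma pivot_size_2: "k p = 2 \<Longrightarrow> pivot p = c (start p)"
  using size_zero [of p] P_Suc_at_0 [of "Suc (start p)"] P_start_nonzero [of p]
  by (simp add: pivot_def start_Suc split: if_splits)

text \<open>
  This is the recurrence at \<open>0\<close> with \<open>n = start p\<close>, divided by the value of \<open>P n\<close>. A block of size
  two at \<open>p\<close> means that the next value vanishes, and one at \<open>p - 1\<close> that the preceding value does;
  the corresponding term of the recurrence then drops out on both sides.
\<close>
lemma pivot_recurrence:
  "(if k p = 1 then pivot p else 0) + (if 0 < p \<and> k (p - 1) = 1 then multiplier p else 0) = b (start p)"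
proof -
  have "poly (P (Suc (start p))) 0 = - (if k p = 1 then pivot p else 0) * poly (P (start p)) 0"
    using size_zero [of p] P_start_nonzero [of p] by (simp add: pivot_def start_Suc)
  moreover have "(if start p = 0 then 0 else c (start p - 1) * poly (P (start p - 1)) 0)
      = - (if 0 < p \<and> k (p - 1) = 1 then multiplier p else 0) * poly (P (start p)) 0"
  proof (cases p)
    case (Suc q)
    show ?thesis
    proof (cases "k q = 1")
      case True
      then show ?thesis
        using P_start_nonzero [of q] P_start_nonzero [of "Suc q"]
        by (simp add: Suc start_Suc multiplier_def pivot_def)
    next
      case False
      then have "k q = 2" "poly (P (Suc (start q))) 0 = 0"
        using size_zero [of q] by (auto split: if_splits)
      then show ?thesis by (simp add: Suc start_Suc)
    qed
  qed simp
  ultimately have "- (if k p = 1 then pivot p else 0) * poly (P (start p)) 0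
      = (- b (start p) + (if 0 < p \<and> k (p - 1) = 1 then multiplier p else 0)) * poly (P (start p)) 0"
    using P_Suc_at_0 [of "start p"] by (simp add: algebra_simps)
  then have "- (if k p = 1 then pivot p else 0)
      = - b (start p) + (if 0 < p \<and> k (p - 1) = 1 then multiplier p else 0)"
    using P_start_nonzero [of p] by (metis mult_right_cancel)
  then show ?thesis by linarith
qed

lemma factor_equations_solution: "factor_equations b c multiplier pivot (\<lambda>p. b (Suc (start p))) p"
  using pivot_recurrence [of p] pivot_size_2 [of p] pivot_nonzero
  by (simp add: factor_equations_def multiplier_def)

text \<open>
  The equation for the subdiagonal determines \<open>l p\<close> because the previous pivot is nonzero; the
  diagonal equation, or the second row of the block, then determines \<open>u0 p\<close>. The
  restriction \<open>0 < p\<close> reflects that the top block row of \<open>L\<close> has no block left of the diagonal.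
\<close>
lemma factor_equations_unique:
  assumes "\<And>p. factor_equations b c l u0 u1 p"
  shows "u0 p = pivot p" and "0 < p \<Longrightarrow> l p = multiplier p"
    and "k p = 2 \<Longrightarrow> u1 p = b (Suc (start p))"
proof -
  have l: "l p = multiplier p" if "0 < p" "u0 (p - 1) = pivot (p - 1)" for p
    using assms [of p] that pivot_nonzero [of "p - 1"]
    by (auto simp: factor_equations_def multiplier_def field_simps split: if_splits)
  have u: "u0 p = pivot p" for p
  proof (induction p rule: less_induct)
    case (less p)
    show ?case
    proof (cases "k p = 2")
      case True
      then show ?thesis using assms [of p] pivot_size_2 by (simp add: factor_equations_def)
    next
      case False
      then have "k p = 1" using size by blast
      moreover have "l p = multiplier p" if "0 < p"
        using l less.IH [of "p - 1"] that by simp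
      ultimately show ?thesis
        using assms [of p] pivot_recurrence [of p] by (simp add: factor_equations_def split: if_splits)
    qed
  qed
  show "u0 p = pivot p" by (rule u)
  show "l p = multiplier p" if "0 < p" using l u that by blast
  show "u1 p = b (Suc (start p))" if "k p = 2"
    using assms [of p] that by (simp add: factor_equations_def)
qed

lemma block_LU_factorization_unique_exists:
  "\<exists>!LU. \<exists>l u0 u1. block_LU_factorization k (monic_jacobi b c) l u0 u1 (fst LU) (snd LU)"
proof -
  define u where "u = (\<lambda>p. b (Suc (start p)))"
  obtain L U where L: "has_blocks k (block_L k multiplier) L"
    and U: "has_blocks k (block_U k pivot u) U"
    using has_blocks_exists by metis
  have "block_LU_factorization k (monic_jacobi b c) multiplier pivot u L U"
    using L U factor_equations_solution unfolding u_def block_LU_factorization_iff by blast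
  then have "\<exists>l u0 u1. block_LU_factorization k (monic_jacobi b c) l u0 u1 (fst (L, U)) (snd (L, U))"
    by auto
  moreover have "L' = L \<and> U' = U"
    if "block_LU_factorization k (monic_jacobi b c) l u0 u1 L' U'" for l u0 u1 L' U'
  proof -
    from that have L': "has_blocks k (block_L k l) L'" and U': "has_blocks k (block_U k u0 u1) U'"
      and eqs: "\<And>p. factor_equations b c l u0 u1 p"
      by (simp_all add: block_LU_factorization_iff)
    note sol = factor_equations_unique [OF eqs]
    have "block_L k l p q = block_L k multiplier p q" for p q
      using sol(2) [of p] by (cases p) (auto simp: block_L_def)
    then have "block_L k l = block_L k multiplier"
      by (intro ext)
    moreover have "block_U k u0 u1 p q = block_U k pivot u p q" for p q
      using size [of p] sol(3) [of p] by (auto simp: block_U_def sol(1) u_def)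
    then have "block_U k u0 u1 = block_U k pivot u"
      by (intro ext)
    ultimately show ?thesis
      using L U L' U' has_blocks_unique by metis
  qed
  then have "LU = (L, U)"
    if "\<exists>l u0 u1. block_LU_factorization k (monic_jacobi b c) l u0 u1 (fst LU) (snd LU)" for LU
    using that by (metis prod.collapse)
  ultimately show ?thesis by (rule ex1I)
qed

end

section \<open>The factorization theorem\<close>

text \<open>
  The algebraic content of the theorem: the sequence \<open>s\<close> enters only as the moment sequence of the
  functional. By induction the blocks of size \<open>\<kk> j\<close> start at the normal indices, which is the
  situation in which the factor equations have been solved.
\<close>
lemma (in orthogonal_recurrence) block_LU_of_normal_indices:
  fixes J :: inf_mat and \<nn> \<kk> :: "nat \<Rightarrow> nat"
  assumes hankel: "\<And>i. s i = E (monom 1 i)"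
    and J_def: "J = monic_jacobi b c"
    and n_def: "\<nn> = normal_index (\<lambda>j. s (j + 1))"
    and k_def: "\<kk> = (\<lambda>j. \<nn> (j + 1) - \<nn> j)"
  shows "infinite (normal_index_set (\<lambda>j. s (j + 1))) \<and>
    (\<forall>j. \<kk> j \<in> {1, 2}) \<and>
    (\<exists>!LU. \<exists>l u0 u1. block_LU_factorization \<kk> J l u0 u1 (fst LU) (snd LU)) \<and>
    (\<forall>j. poly (P (\<nn> j)) 0 \<noteq> 0) \<and>
    (\<forall>l u0 u1 L U. block_LU_factorization \<kk> J l u0 u1 L U \<longrightarrow>
       (\<forall>j. u0 j = - (poly (P (\<nn> (j + 1))) 0 / poly (P (\<nn> j)) 0) \<and>
            (\<kk> j = 2 \<longrightarrow> u1 j = b (\<nn> j + 1))))"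
proof -
  have normal: "n \<in> normal_index_set (\<lambda>j. s (j + 1)) \<longleftrightarrow> poly (P n) 0 \<noteq> 0" if "1 \<le> n" for n
    using shifted_hankel_det_nonzero_iff [of n] that by (simp add: normal_index_set_def hankel)
  note normals = normal_indices_of_isolated_zeros [where a = "\<lambda>n. poly (P n) 0",
      OF normal no_consecutive_zeros, simplified P_0 poly_1, OF _ one_neq_zero, folded n_def]
  have \<kk>: "\<kk> j = (if poly (P (Suc (\<nn> j))) 0 = 0 then 2 else 1)" for j
    using normals(3) [of j] by (simp add: k_def)
  have size: "\<kk> j = 1 \<or> \<kk> j = 2" for j
    by (simp add: \<kk>)
  interpret block_sizes \<kk>
    by standard (rule size)
  have start: "start j = \<nn> j" for j
  proof (induction j)
    case 0
    show ?case by (simp add: n_def normal_index_def)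
  next
    case (Suc j)
    show ?case
      unfolding start_Suc Suc using normals(3) [of j] \<kk> [of j] by simp
  qed
  interpret jacobi_blocks E P b c \<kk>
    by standard (unfold start, rule \<kk>)
  show ?thesis
  proof (intro conjI allI impI)
    show "infinite (normal_index_set (\<lambda>j. s (j + 1)))"
      using normals(1) by simp
    show "\<exists>!LU. \<exists>l u0 u1. block_LU_factorization \<kk> J l u0 u1 (fst LU) (snd LU)"
      unfolding J_def by (rule block_LU_factorization_unique_exists)
    fix l u0 u1 L U j
    assume "block_LU_factorization \<kk> J l u0 u1 L U"
    then have eqs: "\<And>p. factor_equations b c l u0 u1 p"
      by (simp add: J_def block_LU_factorization_iff)
    show "u0 j = - (poly (P (\<nn> (j + 1))) 0 / poly (P (\<nn> j)) 0)"
      using factor_equations_unique(1) [OF eqs] by (simp add: pivot_def start)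
    show "u1 j = b (\<nn> j + 1)" if "\<kk> j = 2"
      using factor_equations_unique(3) [OF eqs that] by (simp add: start)
  qed (use size P_start_nonzero start in auto)
qed

theorem proposition3p1:
  fixes F :: "complex \<Rightarrow> complex" and s :: "nat \<Rightarrow> real" and \<sigma> :: "real measure"
    and P :: "nat \<Rightarrow> real poly" and b c :: "nat \<Rightarrow> real"
    and J :: inf_mat and \<nn> \<kk> :: "nat \<Rightarrow> nat"
  assumes "F \<in> nevanlinna_minus_infinity"
    and "has_asymptotic_coeffs F s"
    and "representing_measure F \<sigma>"
    and nonrational: "infinite (measure_support \<sigma>)"
    and "monic_orthogonal_polys (scale_measure (ennreal (1 / s 0)) \<sigma>) P"
    and "jacobi_recurrence P b c"
    and J_def: "J = monic_jacobi b c"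
    and n_def: "\<nn> = normal_index (\<lambda>j. s (j + 1))"
    and k_def: "\<kk> = (\<lambda>j. \<nn> (j + 1) - \<nn> j)"
  shows "infinite (normal_index_set (\<lambda>j. s (j + 1))) \<and>
    (\<forall>j. \<kk> j \<in> {1, 2}) \<and>
    (\<exists>!LU. \<exists>l u0 u1. block_LU_factorization \<kk> J l u0 u1 (fst LU) (snd LU)) \<and>
    (\<forall>j. poly (P (\<nn> j)) 0 \<noteq> 0) \<and>
    (\<forall>l u0 u1 L U. block_LU_factorization \<kk> J l u0 u1 L U \<longrightarrow>
       (\<forall>j. u0 j = - (poly (P (\<nn> (j + 1))) 0 / poly (P (\<nn> j)) 0) \<and>
            (\<kk> j = 2 \<longrightarrow> u1 j = b (\<nn> j + 1))))"
proof -
  define E where "E p = (\<integral>t. poly p t \<partial>\<sigma>)" for p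
  have "orthogonal_recurrence E P b c"
    unfolding E_def by (rule orthogonal_recurrence_of_measure) (use assms in auto)
  moreover have "s i = E (monom 1 i)" for i
    using asymptotic_coeffs_eq_moments assms(2,3) by (simp add: E_def poly_monom)
  ultimately show ?thesis
    using J_def n_def k_def by (rule orthogonal_recurrence.block_LU_of_normal_indices)
qed

end
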